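(* Let $n\ge 1$ be a natural number and let $p\in[0,1]$. For events $A_1,\dots,A_n$ on a common probability space, let $E$ denote the event that exactly one of $A_1,\dots,A_n$ occurs. Then $$\min \mathsf{P}(E)=np\,\big(1-(n-1)p\big)_+,$$ where the minimum is taken over all pairwise independent events $A_1,\dots,A_n$ each of probability $p$. That is, $\mathsf{P}(E)\ge np\,(1-(n-1)p)_+$ for all probability spaces and all pairwise independent events $A_1,\dots,A_n$ on them with $\mathsf{P}(A_j)=p$ for every $j\in\{1,\dots,n\}$, and there exist a probability space and such events on it for which equality holds.
   Context: For real $x$, $x_+:=\max(0,x)$. Events $A_1,\dots,A_n$ are pairwise independent if $\mathsf{P}(A_i\cap A_j)=\mathsf{P}(A_i)\mathsf{P}(A_j)$ for all distinct $i,j\in\{1,\dots,n\}$. The underlying probability space is not fixed: it is allowed to vary together with the events $A_1,\dots,A_n$. *)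

theory Defs
  imports "HOL-Probability.Probability"
begin

(* Only pairs of distinct indices are constrained; the library's indep_events is mutual independence. *)
definition pairwise_indep_events :: "'a measure \<Rightarrow> nat \<Rightarrow> (nat \<Rightarrow> 'a set) \<Rightarrow> bool" where
  "pairwise_indep_events M n A \<longleftrightarrow>
     (\<forall>i\<in>{1..n}. A i \<in> sets M) \<and>
     (\<forall>i\<in>{1..n}. \<forall>j\<in>{1..n}. i \<noteq> j \<longrightarrow>
        measure M (A i \<inter> A j) = measure M (A i) * measure M (A j))"

definition exactly_one :: "'a measure \<Rightarrow> nat \<Rightarrow> (nat \<Rightarrow> 'a set) \<Rightarrow> 'a set" where
  "exactly_one M n A = {\<omega> \<in> space M. \<exists>!i. i \<in> {1..n} \<and> \<omega> \<in> A i}"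

definition pos_part :: "real \<Rightarrow> real" where
  "pos_part x = max 0 x"

end

theory Submission
  imports Defs "HOL-Library.Nat_Bijection"
begin

text \<open>
  Write \<open>X\<close> for the number of events that occur, and \<open>u = (n - 1) p\<close>.

  For the bound, split \<open>X = 1\<close> according to which event occurs. The part of \<open>A i\<close> on which no other
  event occurs has probability at least \<open>p - (n - 1) p\<^sup>2\<close>, since pairwise independence gives each
  of the \<open>n - 1\<close> intersections with another event the probability \<open>p\<^sup>2\<close>. Summing over \<open>i\<close> yields
  \<open>n p (1 - u)\<close> (\<open>measure_exactly_one_ge\<close>).

  For sharpness, choose a law for \<open>X\<close> and, given \<open>X = k\<close>, let a uniformly random set of \<open>k\<close> indices
  occur (\<open>exchangeable_events_exist\<close>). Pairwise independence with probability \<open>p\<close> then says only that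
  \<open>X\<close> and \<open>X choose 2\<close> have the expectations \<open>n p\<close> and \<open>(n choose 2) p\<^sup>2\<close>. Since the
  bound loses nothing exactly when \<open>X \<le> 2\<close>, a law on \<open>{0, 1, 2}\<close> is wanted while \<open>u \<le> 1\<close>; for
  larger \<open>u\<close> it suffices to avoid the value 1. Both are achieved by concentrating the positive
  values of \<open>X\<close> on two consecutive integers \<open>a\<close> and \<open>a + 1\<close> with \<open>a - 1 \<le> u \<le> a\<close>
  (\<open>two_level_law\<close>). The delicate point is that the total mass on \<open>a\<close> and \<open>a + 1\<close> does not exceed 1.
\<close>

section \<open>The lower bound\<close>

lemma exactly_one_eq_Union:
  assumes "\<And>i. i \<in> {1..n} \<Longrightarrow> A i \<in> sets M"
  shows "exactly_one M n A = (\<Union>i\<in>{1..n}. A i - (\<Union>j\<in>{1..n} - {i}. A i \<inter> A j))"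
proof -
  have "A i \<subseteq> space M" if "i \<in> {1..n}" for i
    using assms[OF that] by (rule sets.sets_into_space)
  then show ?thesis
    unfolding exactly_one_def by blast
qed

text \<open>
  Only the union bound is lossy here: it counts a point of \<open>A i\<close> once for every other event that
  occurs there.
\<close>

lemma measure_exactly_one_ge:
  fixes p :: real
  assumes "prob_space M" and indep: "pairwise_indep_events M n A"
    and prob: "\<And>j. j \<in> {1..n} \<Longrightarrow> measure M (A j) = p" and "n \<ge> 1"
  shows "measure M (exactly_one M n A) \<ge> real n * p * (1 - (real n - 1) * p)"
proof -
  interpret prob_space M by fact
  have meas: "A i \<in> sets M" if "i \<in> {1..n}" for i
    using indep that by (simp add: pairwise_indep_events_def)
  define U where "U i = (\<Union>j\<in>{1..n} - {i}. A i \<inter> A j)" for i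
  have U_sets: "U i \<in> sets M" if "i \<in> {1..n}" for i
    unfolding U_def using meas that by blast
  have only_ge: "measure M (A i - U i) \<ge> p - (real n - 1) * p\<^sup>2" if i: "i \<in> {1..n}" for i
  proof -
    have "measure M (U i) \<le> (\<Sum>j\<in>{1..n} - {i}. measure M (A i \<inter> A j))"
      unfolding U_def by (rule finite_measure_subadditive_finite) (use meas i in auto)
    also have "\<dots> = (\<Sum>j\<in>{1..n} - {i}. p\<^sup>2)"
      by (rule sum.cong) (use indep i prob in \<open>auto simp: pairwise_indep_events_def power2_eq_square\<close>)
    also have "\<dots> = (real n - 1) * p\<^sup>2"
      using i \<open>n \<ge> 1\<close> by (simp add: of_nat_diff)
    finally have "measure M (U i) \<le> (real n - 1) * p\<^sup>2" .
    moreover have "measure M (A i - U i) = measure M (A i) - measure M (U i)"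
      by (rule finite_measure_Diff) (use meas U_sets i in \<open>auto simp: U_def\<close>)
    ultimately show ?thesis
      using prob[OF i] by simp
  qed
  have "real n * p * (1 - (real n - 1) * p) = (\<Sum>i\<in>{1..n}. p - (real n - 1) * p\<^sup>2)"
    by (simp add: algebra_simps power2_eq_square)
  also have "\<dots> \<le> (\<Sum>i\<in>{1..n}. measure M (A i - U i))"
    by (rule sum_mono) (rule only_ge)
  also have "\<dots> = measure M (\<Union>i\<in>{1..n}. A i - U i)"
    by (rule finite_measure_finite_Union[symmetric])
       (use meas U_sets in \<open>auto simp: disjoint_family_on_def U_def\<close>)
  also have "\<dots> = measure M (exactly_one M n A)"
    using exactly_one_eq_Union[of n A M] meas by (simp add: U_def)
  finally show ?thesis .
qed

section \<open>Exchangeable events with a prescribed number of occurrences\<close>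

text \<open>
  Both sides count pairs of nested subsets of \<open>V\<close>, the inner of size \<open>card T\<close> and the outer of size
  \<open>k\<close>; on the left, by symmetry, \<open>T\<close> stands for any inner set. The product form also covers
  \<open>k < card T\<close> and \<open>k > card V\<close>, where both sides vanish.
\<close>

lemma card_supersets_of_size:
  assumes "finite V" and "T \<subseteq> V"
  shows "card {S \<in> Pow V. T \<subseteq> S \<and> card S = k} * (card V choose card T)
           = (card V choose k) * (k choose card T)"
proof (cases "card T \<le> k \<and> k \<le> card V")
  case True
  have finT: "finite T"
    using assms finite_subset by blast
  have "bij_betw (\<lambda>R. R \<union> T) {R. R \<subseteq> V - T \<and> card R = k - card T}
          {S \<in> Pow V. T \<subseteq> S \<and> card S = k}"
  proof (rule bij_betw_byWitness[where f' = "\<lambda>S. S - T"])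
    show "(\<lambda>R. R \<union> T) ` {R. R \<subseteq> V - T \<and> card R = k - card T}
            \<subseteq> {S \<in> Pow V. T \<subseteq> S \<and> card S = k}"
    proof safe
      fix R assume R: "R \<subseteq> V - T" "card R = k - card T"
      then have "finite R" "R \<inter> T = {}"
        using assms finite_subset by blast+
      then show "card (R \<union> T) = k"
        using R finT True by (simp add: card_Un_disjoint)
    qed (use assms in auto)
    show "(\<lambda>S. S - T) ` {S \<in> Pow V. T \<subseteq> S \<and> card S = k}
            \<subseteq> {R. R \<subseteq> V - T \<and> card R = k - card T}"
      using finT by (auto simp: card_Diff_subset)
  qed auto
  then have "card {S \<in> Pow V. T \<subseteq> S \<and> card S = k} = (card V - card T) choose (k - card T)"
    using assms finT by (simp add: bij_betw_same_card[symmetric] n_subsets card_Diff_subset)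
  then show ?thesis
    using choose_mult[of "card T" k "card V"] True by (simp add: mult.commute)
next
  case False
  have "{S \<in> Pow V. T \<subseteq> S \<and> card S = k} = {}"
  proof -
    have "card T \<le> card S \<and> card S \<le> card V" if "S \<subseteq> V" "T \<subseteq> S" for S
      using that assms by (meson card_mono finite_subset)
    then show ?thesis using False by blast
  qed
  moreover have "(card V choose k) * (k choose card T) = 0"
    using False by (auto simp: not_le binomial_eq_0)
  ultimately show ?thesis
    by (simp only: card.empty mult_zero_left)
qed

text \<open>
  If \<open>w\<close> is the law of the size of a random subset of \<open>V\<close> that is uniform given its size, this is
  the probability that the subset contains \<open>T\<close>: by symmetry, the expected number of subsets of size
  \<open>card T\<close> that it contains, divided by the number of all such subsets of \<open>V\<close>.
\<close>

lemma sum_uniform_over_sizes: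
  fixes w :: "nat \<Rightarrow> real"
  assumes "finite V" and "T \<subseteq> V"
  shows "(\<Sum>S | S \<in> Pow V \<and> T \<subseteq> S. w (card S) / (card V choose card S))
           = (\<Sum>k\<le>card V. w k * (k choose card T)) / (card V choose card T)"
proof -
  have le: "card T \<le> card V"
    using assms by (simp add: card_mono)
  have "(\<Sum>S | S \<in> Pow V \<and> T \<subseteq> S. w (card S) / (card V choose card S))
      = (\<Sum>k\<le>card V. \<Sum>S | S \<in> {S \<in> Pow V. T \<subseteq> S} \<and> card S = k.
           w (card S) / (card V choose card S))"
    by (rule sum.group[symmetric]) (use assms in \<open>auto intro: card_mono\<close>)
  also have "\<dots> = (\<Sum>k\<le>card V. w k * (k choose card T) / (card V choose card T))"
  proof (rule sum.cong[OF refl])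
    fix k assume k: "k \<in> {..card V}"
    let ?N = "card {S \<in> Pow V. T \<subseteq> S \<and> card S = k}"
    have "real (?N * (card V choose card T)) = real ((card V choose k) * (k choose card T))"
      using card_supersets_of_size[OF assms] by simp
    then have N: "real ?N / (card V choose k) = (k choose card T) / (card V choose card T)"
      using k le by (simp add: divide_simps mult.commute)
    have "(\<Sum>S | S \<in> {S \<in> Pow V. T \<subseteq> S} \<and> card S = k. w (card S) / (card V choose card S))
        = (\<Sum>S \<in> {S \<in> Pow V. T \<subseteq> S \<and> card S = k}. w k / (card V choose k))"
      by (rule sum.cong) auto
    also have "\<dots> = w k * (real ?N / (card V choose k))"
      by simp
    also have "\<dots> = w k * (k choose card T) / (card V choose card T)"
      unfolding N by simp
    finally show "(\<Sum>S | S \<in> {S \<in> Pow V. T \<subseteq> S} \<and> card S = k. w (card S) / (card V choose card S))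
        = w k * (k choose card T) / (card V choose card T)" .
  qed
  finally show ?thesis
    by (simp add: sum_divide_distrib)
qed

text \<open>
  The natural sample space consists of the subsets of \<open>{1..n}\<close>, with \<open>A i\<close> the family of sets that
  contain \<open>i\<close>; the binary encoding of finite sets moves it to the natural numbers. Taking \<open>T\<close> of
  size 1 and 2 turns the marginal probabilities and the pairwise intersections into binomial
  moments of \<open>w\<close>.
\<close>

lemma exchangeable_events_exist:
  fixes w :: "nat \<Rightarrow> real"
  assumes nonneg: "\<And>k. w k \<ge> 0" and total: "(\<Sum>k\<le>n. w k) = 1" and "n \<ge> 1"
  obtains M :: "nat measure" and A where "prob_space M"
    and "\<And>i. A i \<in> sets M"
    and "\<And>T. T \<subseteq> {1..n} \<Longrightarrow>
           measure M {\<omega> \<in> space M. \<forall>i\<in>T. \<omega> \<in> A i} = (\<Sum>k\<le>n. w k * (k choose card T)) / (n choose card T)"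
    and "measure M (exactly_one M n A) = w 1"
proof -
  define V where "V = {1..n}"
  have V: "finite V" "card V = n"
    by (simp_all add: V_def)
  define f where "f S = w (card S) / (card V choose card S)" for S :: "nat set"
  define \<Omega> where "\<Omega> = set_encode ` Pow V"
  define M where "M = point_measure \<Omega> (\<lambda>x. ennreal (f (set_decode x)))"
  define A where "A i = {x \<in> \<Omega>. i \<in> set_decode x}" for i
  have fin: "finite \<Omega>"
    by (simp add: \<Omega>_def V)
  have f_nonneg: "f S \<ge> 0" for S
    by (simp add: f_def nonneg)
  have decode: "set_decode (set_encode S) = S" if "S \<subseteq> V" for S
    using that V(1) by (simp add: finite_subset)
  have measure_eq: "measure M {x \<in> \<Omega>. P (set_decode x)} = (\<Sum>S | S \<in> Pow V \<and> P S. f S)" for P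
  proof -
    have eq: "{x \<in> \<Omega>. P (set_decode x)} = set_encode ` {S \<in> Pow V. P S}"
      by (auto simp: \<Omega>_def decode)
    have "measure M {x \<in> \<Omega>. P (set_decode x)} = (\<Sum>x | x \<in> \<Omega> \<and> P (set_decode x). f (set_decode x))"
      using fin f_nonneg
      by (simp add: M_def measure_def emeasure_point_measure_finite sum_nonneg)
    also have "\<dots> = (\<Sum>S | S \<in> Pow V \<and> P S. f (set_decode (set_encode S)))"
      unfolding eq
      by (rule sum.reindex_cong[OF _ refl refl]) (auto intro!: inj_onI dest!: arg_cong[of _ _ set_decode] simp: decode)
    also have "\<dots> = (\<Sum>S | S \<in> Pow V \<and> P S. f S)"
      by (rule sum.cong) (auto simp: decode)
    finally show ?thesis .
  qed
  have space: "space M = \<Omega>"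
    by (simp add: M_def space_point_measure)
  have inter: "measure M {\<omega> \<in> space M. \<forall>i\<in>T. \<omega> \<in> A i} = (\<Sum>k\<le>n. w k * (k choose card T)) / (n choose card T)"
    if "T \<subseteq> {1..n}" for T
  proof -
    have "{\<omega> \<in> space M. \<forall>i\<in>T. \<omega> \<in> A i} = {x \<in> \<Omega>. T \<subseteq> set_decode x}"
      by (auto simp: space A_def)
    then show ?thesis
      using sum_uniform_over_sizes[OF V(1) that[folded V_def], of w]
      by (simp add: measure_eq[of "\<lambda>S. T \<subseteq> S"] f_def V(2))
  qed
  show thesis
  proof
    \<comment> \<open>No condition is imposed by \<open>T = {}\<close>, so its formula computes the total mass.\<close>
    have "measure M (space M) = 1"
      using inter[of "{}"] total by simp
    moreover have "emeasure M (space M) \<noteq> \<infinity>"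
      by (simp add: M_def space_point_measure emeasure_point_measure_finite fin)
    ultimately show "prob_space M"
      by (intro prob_spaceI) (simp add: emeasure_eq_ennreal_measure)
    show "A i \<in> sets M" for i
      by (auto simp: M_def sets_point_measure A_def)
    have ex1: "(\<exists>!i. i \<in> S) \<longleftrightarrow> card S = 1" for S :: "nat set"
      by (auto simp: card_1_singleton_iff)
    have "exactly_one M n A = {x \<in> \<Omega>. card (set_decode x) = 1}"
    proof -
      have "(i \<in> {1..n} \<and> x \<in> A i) \<longleftrightarrow> i \<in> set_decode x" if "x \<in> \<Omega>" for x i
        using that unfolding V_def[symmetric] by (auto simp: A_def \<Omega>_def decode)
      then have "(\<exists>!i. i \<in> {1..n} \<and> x \<in> A i) \<longleftrightarrow> card (set_decode x) = 1" if "x \<in> \<Omega>" for x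
        using that by (simp only: ex1)
      then show ?thesis
        unfolding exactly_one_def space by blast
    qed
    then have "measure M (exactly_one M n A) = (\<Sum>S | S \<in> Pow V \<and> card S = 1. f S)"
      by (simp only: measure_eq[of "\<lambda>S. card S = 1"])
    also have "\<dots> = (\<Sum>S | S \<in> Pow V \<and> card S = 1. w 1 / n)"
      by (rule sum.cong) (auto simp: f_def V)
    also have "\<dots> = w 1"
      using n_subsets[OF V(1), of 1] \<open>n \<ge> 1\<close> by (simp add: V)
    finally show "measure M (exactly_one M n A) = w 1" .
  qed (rule inter)
qed

section \<open>The extremal law of the number of occurrences\<close>

text \<open>
  Size-biasing explains the weights: for \<open>p > 0\<close>, if \<open>X\<close> has law \<open>w\<close>, then \<open>q k = k w k / (n p)\<close> must be a
  probability law on the positive integers under which \<open>k - 1\<close> has mean \<open>u = (n - 1) p\<close>. The law \<open>q\<close> on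
  \<open>{a, a + 1}\<close> with \<open>q a = a - u\<close> has this property, and it is the choice that makes
  the mean of \<open>1 / k\<close>, and hence the probability \<open>n p \<Sum>k. q k / k\<close> of \<open>X > 0\<close>, as small as possible.
  The value \<open>w 1\<close> is nonzero only if \<open>a = 1\<close> and \<open>u < 1\<close>.
\<close>

lemma two_level_law:
  fixes p :: real
  assumes n: "n \<ge> 1" and p: "0 \<le> p" "p \<le> 1"
  obtains w :: "nat \<Rightarrow> real" where "\<And>k. w k \<ge> 0" and "(\<Sum>k\<le>n. w k) = 1"
    and "(\<Sum>k\<le>n. w k * k) = real n * p"
    and "(\<Sum>k\<le>n. w k * (k choose 2)) = (n choose 2) * p\<^sup>2"
    and "w 1 = real n * p * pos_part (1 - (real n - 1) * p)"
proof (cases "n = 1")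
  case True
  show ?thesis
    by (rule that[of "\<lambda>k. if k = 0 then 1 - p else if k = 1 then p else 0"])
       (use True p in \<open>auto simp: pos_part_def binomial_eq_0\<close>)
next
  case False
  define u where "u = (real n - 1) * p"
  have u: "0 \<le> u" "u \<le> real n - 1"
    using p n by (auto simp: u_def mult_left_le)
  \<comment> \<open>Rounding up rather than down keeps \<open>a + 1 \<le> n\<close> even for \<open>p = 1\<close>, where \<open>u = n - 1\<close>.\<close>
  define a where "a = max 1 (nat \<lceil>u\<rceil>)"
  have a1: "a \<ge> 1" and ua: "u \<le> real a" and an: "a \<le> n - 1"
    using u n False by (auto simp: a_def ceiling_le_iff nat_le_iff of_nat_diff; linarith)+
  have au: "real a - 1 \<le> u"
    using u by (cases "nat \<lceil>u\<rceil> \<ge> 1") (auto simp: a_def max_def; linarith)+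
  define x y where "x = real n * p * (a - u) / a" and "y = real n * p * (u - (real a - 1)) / (a + 1)"
  define w where "w k = (if k = 0 then 1 - x - y else if k = a then x else if k = a + 1 then y else 0)" for k
  have xa: "x * a = real n * p * (a - u)" and ya: "y * (a + 1) = real n * p * (u - (real a - 1))"
    using a1 by (simp_all add: x_def y_def)
  have x0: "x \<ge> 0" and y0: "y \<ge> 0"
    using p ua au by (auto simp: x_def y_def)
  have sum_w: "(\<Sum>k\<le>n. w k * g k) = (1 - x - y) * g 0 + x * g a + y * g (a + 1)" for g :: "nat \<Rightarrow> real"
  proof -
    have "(\<Sum>k\<le>n. w k * g k) = (\<Sum>k\<in>{0, a, a + 1}. w k * g k)"
      by (rule sum.mono_neutral_right) (use an a1 n in \<open>auto simp: w_def\<close>)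
    then show ?thesis
      using a1 by (simp add: w_def)
  qed
  \<comment> \<open>Cleared of denominators, the claim follows from \<open>u (2 a - u) \<le> a\<^sup>2\<close> and
    \<open>n / (n - 1) \<le> (a + 1) / a\<close>; the second holds because \<open>a\<close> is an integer below \<open>n\<close>.\<close>
  have xy: "x + y \<le> 1"
  proof -
    have "(real n - 1) * ((x + y) * (a * (a + 1))) = n * (u * (2 * a - u))"
    proof -
      have "(x + y) * (a * (a + 1)) = (x * a) * (a + 1) + (y * (a + 1)) * a"
        by (simp add: algebra_simps)
      also have "\<dots> = n * p * (2 * a - u)"
        unfolding xa ya by (simp add: algebra_simps)
      finally show ?thesis by (simp add: u_def)
    qed
    also have "\<dots> \<le> n * (real a * a)"
    proof (intro mult_left_mono)
      have "0 \<le> (a - u)\<^sup>2" by simp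
      then show "u * (2 * a - u) \<le> real a * a"
        by (simp add: power2_eq_square algebra_simps)
    qed simp
    also have "\<dots> \<le> (real n - 1) * (a * (a + 1))"
    proof -
      have "real a * a \<le> real a * (real n - 1)"
        using an n by (intro mult_left_mono) (auto simp: of_nat_diff)
      then show ?thesis by (simp add: algebra_simps)
    qed
    finally have "(x + y) * real (a * (a + 1)) \<le> 1 * real (a * (a + 1))"
      using n False by (subst (asm) mult_le_cancel_left_pos) (auto simp: algebra_simps)
    then show ?thesis
      using a1 by (subst (asm) mult_le_cancel_right_pos) (simp_all only: of_nat_0_less_iff, auto)
  qed
  have choose2: "real (m choose 2) = real m * (real m - 1) / 2" for m
    by (induction m) (auto simp: numeral_2_eq_2 field_simps)
  show ?thesis
  proof (rule that[of w])
    show "w k \<ge> 0" for k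
      using x0 y0 xy by (simp add: w_def)
    show "(\<Sum>k\<le>n. w k) = 1"
      using sum_w[of "\<lambda>_. 1"] by simp
    show "(\<Sum>k\<le>n. w k * k) = real n * p"
      using sum_w[of real] xa ya by (simp add: algebra_simps)
    have "(\<Sum>k\<le>n. w k * (k choose 2)) = ((x * a) * (real a - 1) + (y * (a + 1)) * a) / 2"
      unfolding sum_w choose2 by (simp add: algebra_simps add_divide_distrib diff_divide_distrib)
    also have "\<dots> = n * p * u / 2"
      unfolding xa ya by (simp add: algebra_simps)
    also have "\<dots> = (n choose 2) * p\<^sup>2"
      by (simp add: choose2 u_def power2_eq_square)
    finally show "(\<Sum>k\<le>n. w k * (k choose 2)) = (n choose 2) * p\<^sup>2" .
    show "w 1 = real n * p * pos_part (1 - (real n - 1) * p)"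
    proof (cases "a = 1")
      case True
      then show ?thesis
        using ua by (simp add: w_def x_def pos_part_def u_def)
    next
      case False
      then have "1 \<le> u"
        using a1 au by linarith
      then show ?thesis
        using False a1 by (simp add: w_def pos_part_def u_def)
    qed
  qed
qed

section \<open>The minimum\<close>

theorem theorem1:
  fixes n :: nat and p :: real
  assumes "n \<ge> 1" and "0 \<le> p" and "p \<le> 1"
  shows "(\<forall>(M :: 'a measure) A.
            prob_space M \<and> pairwise_indep_events M n A \<and>
            (\<forall>j\<in>{1..n}. measure M (A j) = p) \<longrightarrow>
            measure M (exactly_one M n A) \<ge> real n * p * pos_part (1 - (real n - 1) * p)) \<and>
         (\<exists>(M :: nat measure) A.
            prob_space M \<and> pairwise_indep_events M n A \<and>
            (\<forall>j\<in>{1..n}. measure M (A j) = p) \<and>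
            measure M (exactly_one M n A) = real n * p * pos_part (1 - (real n - 1) * p))"
proof (intro conjI allI impI, elim conjE)
  fix M :: "'a measure" and A
  assume "prob_space M" "pairwise_indep_events M n A" "\<forall>j\<in>{1..n}. measure M (A j) = p"
  then have "measure M (exactly_one M n A) \<ge> real n * p * (1 - (real n - 1) * p)"
    using measure_exactly_one_ge assms(1) by blast
  \<comment> \<open>Where the bound is negative, \<open>pos_part\<close> replaces it by the trivial bound 0.\<close>
  then show "measure M (exactly_one M n A) \<ge> real n * p * pos_part (1 - (real n - 1) * p)"
    by (simp add: pos_part_def max_def)
next
  obtain w :: "nat \<Rightarrow> real" where w: "\<And>k. w k \<ge> 0" "(\<Sum>k\<le>n. w k) = 1"
    and mean: "(\<Sum>k\<le>n. w k * k) = real n * p"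
    and pairs: "(\<Sum>k\<le>n. w k * (k choose 2)) = (n choose 2) * p\<^sup>2"
    and w1: "w 1 = real n * p * pos_part (1 - (real n - 1) * p)"
    using two_level_law[OF assms] by blast
  obtain M :: "nat measure" and A where M: "prob_space M" and A: "\<And>i. A i \<in> sets M"
    and inter: "\<And>T. T \<subseteq> {1..n} \<Longrightarrow>
      measure M {\<omega> \<in> space M. \<forall>i\<in>T. \<omega> \<in> A i} = (\<Sum>k\<le>n. w k * (k choose card T)) / (n choose card T)"
    and one: "measure M (exactly_one M n A) = w 1"
    using exchangeable_events_exist[OF w assms(1)] by blast
  have A_space: "A i \<subseteq> space M" for i
    using A by (rule sets.sets_into_space)
  have single: "measure M (A i) = p" if "i \<in> {1..n}" for i
  proof -
    have "{\<omega> \<in> space M. \<forall>j\<in>{i}. \<omega> \<in> A j} = A i"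
      using A_space by auto
    then show ?thesis
      using inter[of "{i}"] that mean assms(1) by simp
  qed
  have double: "measure M (A i \<inter> A j) = p * p" if ij: "i \<in> {1..n}" "j \<in> {1..n}" "i \<noteq> j" for i j
  proof -
    have "{\<omega> \<in> space M. \<forall>k\<in>{i, j}. \<omega> \<in> A k} = A i \<inter> A j"
      using A_space by auto
    moreover have "card {i, j} = 2" "n \<ge> 2"
      using ij by auto
    then have "(n choose card {i, j}) \<noteq> 0" by simp
    ultimately show ?thesis
      using inter[of "{i, j}"] ij pairs \<open>card {i, j} = 2\<close> by (simp add: power2_eq_square)
  qed
  have "pairwise_indep_events M n A"
    using A single double by (simp add: pairwise_indep_events_def)
  then show "\<exists>(M :: nat measure) A.
      prob_space M \<and> pairwise_indep_events M n A \<and>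
      (\<forall>j\<in>{1..n}. measure M (A j) = p) \<and>
      measure M (exactly_one M n A) = real n * p * pos_part (1 - (real n - 1) * p)"
    using M single one w1 by (intro exI[of _ M] exI[of _ A]) auto
qed

end
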